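(* Let $\{a_n\}_{n\ge0}$ be a sequence of nonzero complex numbers, and let $f(z)$ be an entire function with zeros at $\{a_n\}$ listed according to their multiplicities. Suppose $f$ has a zero of order $k\ge0$ at the origin and $$f(z)=z^ke^{g(z)}\prod_{n=0}^\infty\left(1-\frac z{a_n}\right)e^{P_q(z/a_n)},$$ where $P_q$ has constant degree $q$. Set $$\mathcal F\big(\{a_n\}_{n=0}^\infty,q\big)=\prod_{n=0}^\infty\left(1-\frac z{a_n}\right)e^{P_q(z/a_n)},$$ a function with parameters $\{a_n\}_{n=0}^\infty$ and $q$. Let $m$ be a positive integer. If $X$ is a graphical isotropic minimal surface with height function $h(x,y)=\operatorname{Re}(\ln f(z))$, then $h$ admits a decomposition on a simply connected domain excluding $\{a_n\}$ and $0$ into the following components: (1) a finite sum representing $k$ logarithmoids of revolution, given by $k\ln|z|$; (2) a finite sum, over $j=0,1,\dots,m-1$, of isotropic minimal surfaces given by $\operatorname{Re}\ln\left[\mathcal F\big(\{a_{mk_n+j}\}_{k_n=0}^\infty,q\big)\right]$, which are parametrised by the parameters $\{a_{mk_n+j}\}_{k_n=0}^\infty$ and $q$; they are similar to the isotropic minimal surface given by $\operatorname{Re}\ln\left[\mathcal F\big(\{a_n\}_{n=0}^\infty,q\big)\right]$, with the only difference being that the zeros $\{a_n\}_{n=0}^\infty$ are changed to $\{a_{mk_n+j}\}_{k_n=0}^\infty$; (3) a graphical isotropic minimal surface given by the harmonic function $\operatorname{Re}(g(z))$, where $g$ is the entire function appearing in the Weierstrass product formula for $f$. Moreover, since the Weierstrass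 product representation of an entire function is not unique, the corresponding decomposition of the isotropic minimal surface is likewise not uniquely determined.
   Context: Isotropic $3$-space is $\mathbb R^3$ with the degenerate metric $dx^2+dy^2$; a graph $(x,y,h(x,y))$, $z=x+iy$, is an isotropic minimal surface if and only if $\Delta h=0$. The logarithmoid of revolution is the graph of $\ln\sqrt{x^2+y^2}=\ln|z|$. $P_q(w)=w+\frac{w^2}2+\dots+\frac{w^q}q$, with the degree $q$ independent of $n$. The indices are split as $n=mk_n+j$ with $k_n$ a nonnegative integer and $j\in\{0,\dots,m-1\}$. *)

theory Defs
  imports "HOL-Complex_Analysis.Complex_Analysis"
begin

no_notation fps_nth (infixl "$" 75)

section \<open>Surfaces in isotropic 3-space\<close>

text \<open>
  The parameter plane is identified with the complex numbers, \<open>z = x + \<i>y\<close>. Partial derivatives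
  are directional derivatives: \<open>\<partial>/\<partial>x\<close> is \<open>partial 1\<close> and \<open>\<partial>/\<partial>y\<close> is \<open>partial \<i>\<close>.
\<close>

definition partial :: "complex \<Rightarrow> (complex \<Rightarrow> 'b::real_normed_vector) \<Rightarrow> complex \<Rightarrow> 'b" where
  "partial e \<phi> z = vector_derivative (\<lambda>t::real. \<phi> (z + t *\<^sub>R e)) (at 0)"

definition C1_on :: "complex set \<Rightarrow> (complex \<Rightarrow> 'b::real_normed_vector) \<Rightarrow> bool" where
  "C1_on U \<phi> \<longleftrightarrow>
     (\<forall>e\<in>{1, \<i>}. (\<forall>z\<in>U. (\<lambda>t::real. \<phi> (z + t *\<^sub>R e)) differentiable (at 0)) \<and>
                  continuous_on U (partial e \<phi>))"

definition C2_on :: "complex set \<Rightarrow> (complex \<Rightarrow> 'b::real_normed_vector) \<Rightarrow> bool" where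
  "C2_on U \<phi> \<longleftrightarrow> C1_on U \<phi> \<and> (\<forall>e\<in>{1, \<i>}. C1_on U (partial e \<phi>))"

definition laplacian :: "(complex \<Rightarrow> real) \<Rightarrow> complex \<Rightarrow> real" where
  "laplacian h z = partial 1 (partial 1 h) z + partial \<i> (partial \<i> h) z"

definition harmonic_on :: "complex set \<Rightarrow> (complex \<Rightarrow> real) \<Rightarrow> bool" where
  "harmonic_on U h \<longleftrightarrow> C2_on U h \<and> (\<forall>z\<in>U. laplacian h z = 0)"

text \<open>The degenerate metric \<open>dx\<^sup>2 + dy\<^sup>2\<close>.\<close>

definition isotropic_metric :: "real^3 \<Rightarrow> real^3 \<Rightarrow> real" where
  "isotropic_metric u v = u $ 1 * v $ 1 + u $ 2 * v $ 2"

text \<open>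
  First and second fundamental forms of a parametrised surface in isotropic space, in the
  coordinate directions \<open>d, e \<in> {1, \<i>}\<close>. The determinant of the first fundamental form vanishes
  exactly where the surface is singular or its tangent plane is isotropic (vertical).
\<close>

definition first_form :: "(complex \<Rightarrow> real^3) \<Rightarrow> complex \<Rightarrow> complex \<Rightarrow> complex \<Rightarrow> real" where
  "first_form X d e z = isotropic_metric (partial d X z) (partial e X z)"

definition first_form_det :: "(complex \<Rightarrow> real^3) \<Rightarrow> complex \<Rightarrow> real" where
  "first_form_det X z = first_form X 1 1 z * first_form X \<i> \<i> z - (first_form X 1 \<i> z)\<^sup>2"

definition second_form :: "(complex \<Rightarrow> real^3) \<Rightarrow> complex \<Rightarrow> complex \<Rightarrow> complex \<Rightarrow> real" where
  "second_form X d e z =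
     det (vector [partial 1 X z, partial \<i> X z, partial e (partial d X) z] :: real^3^3)
       / sqrt (first_form_det X z)"

definition isotropic_mean_curvature :: "(complex \<Rightarrow> real^3) \<Rightarrow> complex \<Rightarrow> real" where
  "isotropic_mean_curvature X z =
     (first_form X 1 1 z * second_form X \<i> \<i> z - 2 * first_form X 1 \<i> z * second_form X 1 \<i> z
        + first_form X \<i> \<i> z * second_form X 1 1 z) / (2 * first_form_det X z)"

definition isotropic_minimal :: "complex set \<Rightarrow> (complex \<Rightarrow> real^3) \<Rightarrow> bool" where
  "isotropic_minimal U X \<longleftrightarrow>
     C2_on U X \<and> (\<forall>z\<in>U. first_form_det X z > 0 \<and> isotropic_mean_curvature X z = 0)"

definition graph_surface :: "(complex \<Rightarrow> real) \<Rightarrow> complex \<Rightarrow> real^3" where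
  "graph_surface h z = vector [Re z, Im z, h z]"

definition logarithmoid :: "complex \<Rightarrow> real" where
  "logarithmoid z = ln (cmod z)"

text \<open>Graphs are isotropic minimal iff the height function is harmonic.\<close>

lemma has_vector_derivative_vec_nth:
  "(f has_vector_derivative D) F \<Longrightarrow> ((\<lambda>t. f t $ i) has_vector_derivative D $ i) F"
  for f :: "real \<Rightarrow> real^'n"
  by (rule bounded_linear.has_vector_derivative[OF bounded_linear_vec_nth])

lemma has_vector_derivative_vector3:
  fixes a b c :: "real \<Rightarrow> real"
  assumes "(a has_vector_derivative a') F" "(b has_vector_derivative b') F"
    "(c has_vector_derivative c') F"
  shows "((\<lambda>t. vector [a t, b t, c t] :: real^3) has_vector_derivative vector [a', b', c']) F"
proof -
  have eq: "(vector [x, y, z] :: real^3) = x *\<^sub>R axis 1 1 + y *\<^sub>R axis 2 1 + z *\<^sub>R axis 3 1"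
    for x y z :: real
    by (simp add: vec_eq_iff forall_3 axis_def)
  show ?thesis
    unfolding eq
    by (intro has_vector_derivative_add bounded_linear.has_vector_derivative[OF bounded_linear_scaleR_left] assms)
qed

definition has_partial ::
  "(complex \<Rightarrow> 'b::real_normed_vector) \<Rightarrow> complex \<Rightarrow> complex \<Rightarrow> 'b \<Rightarrow> bool" where
  "has_partial \<phi> e z D \<longleftrightarrow> ((\<lambda>t::real. \<phi> (z + t *\<^sub>R e)) has_vector_derivative D) (at 0)"

lemma partial_eqI: "has_partial \<phi> e z D \<Longrightarrow> partial e \<phi> z = D"
  unfolding has_partial_def partial_def by (rule vector_derivative_at)

lemma has_partial_vec_nth: "has_partial \<phi> e z D \<Longrightarrow> has_partial (\<lambda>w. \<phi> w $ i) e z (D $ i)"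
  for \<phi> :: "complex \<Rightarrow> real^'n"
  unfolding has_partial_def by (rule has_vector_derivative_vec_nth)

lemma C1_on_altdef:
  "C1_on U \<phi> \<longleftrightarrow>
     (\<forall>e\<in>{1, \<i>}. (\<forall>z\<in>U. has_partial \<phi> e z (partial e \<phi> z)) \<and> continuous_on U (partial e \<phi>))"
  unfolding C1_on_def has_partial_def partial_def
  by (simp add: vector_derivative_works)

lemma C1_onI:
  assumes "\<And>e z. e \<in> {1, \<i>} \<Longrightarrow> z \<in> U \<Longrightarrow> has_partial \<phi> e z (D e z)"
    and "\<And>e. e \<in> {1, \<i>} \<Longrightarrow> continuous_on U (D e)"
  shows "C1_on U \<phi>"
    and "\<And>e z. e \<in> {1, \<i>} \<Longrightarrow> z \<in> U \<Longrightarrow> partial e \<phi> z = D e z"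
proof -
  show eq: "partial e \<phi> z = D e z" if "e \<in> {1, \<i>}" "z \<in> U" for e z
    using that by (intro partial_eqI assms(1))
  show "C1_on U \<phi>"
    unfolding C1_on_altdef
  proof (intro ballI conjI)
    fix e :: complex assume e: "e \<in> {1, \<i>}"
    show "has_partial \<phi> e z (partial e \<phi> z)" if "z \<in> U" for z
      unfolding eq[OF e that] by (rule assms(1)[OF e that])
    show "continuous_on U (partial e \<phi>)"
      by (rule continuous_on_eq[OF assms(2)[OF e]]) (simp add: eq[OF e])
  qed
qed

lemma has_partial_cong:
  assumes "open U" "z \<in> U" "\<And>w. w \<in> U \<Longrightarrow> \<phi> w = \<psi> w"
  shows "has_partial \<phi> e z D \<longleftrightarrow> has_partial \<psi> e z D"
proof -
  have "((\<lambda>t::real. z + t *\<^sub>R e) \<longlongrightarrow> z + 0 *\<^sub>R e) (nhds 0)"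
    by (intro tendsto_intros filterlim_ident)
  then have "\<forall>\<^sub>F t in nhds (0::real). z + t *\<^sub>R e \<in> U"
    by (rule topological_tendstoD) (use assms(1,2) in simp_all)
  then have *: "\<forall>\<^sub>F t in nhds (0::real). \<phi> (z + t *\<^sub>R e) = \<psi> (z + t *\<^sub>R e)"
    by (rule eventually_mono) (rule assms(3))
  show ?thesis
    unfolding has_partial_def
  proof (rule has_vector_derivative_cong_ev)
    show "\<forall>\<^sub>F t in nhds (0::real). t \<in> UNIV \<longrightarrow> \<phi> (z + t *\<^sub>R e) = \<psi> (z + t *\<^sub>R e)"
      using * by simp
  qed (simp add: assms)
qed

lemma C1_onD:
  assumes "C1_on U \<phi>" "e \<in> {1, \<i>}"
  shows "z \<in> U \<Longrightarrow> has_partial \<phi> e z (partial e \<phi> z)" and "continuous_on U (partial e \<phi>)"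
  using assms unfolding C1_on_altdef by blast+

lemma C1_on_cong:
  assumes "open U" "\<And>w. w \<in> U \<Longrightarrow> \<phi> w = \<psi> w" "C1_on U \<phi>"
  shows "C1_on U \<psi>"
proof (rule C1_onI(1)[where D = "\<lambda>e. partial e \<phi>"])
  show "has_partial \<psi> e z (partial e \<phi> z)" if e: "e \<in> {1, \<i>}" and z: "z \<in> U" for e z
    by (rule iffD1[OF has_partial_cong[OF assms(1) z assms(2)] C1_onD(1)[OF assms(3) e z]])
  show "continuous_on U (partial e \<phi>)" if e: "e \<in> {1, \<i>}" for e
    by (rule C1_onD(2)[OF assms(3) e])
qed

lemma
  fixes \<phi> :: "complex \<Rightarrow> real^'n"
  assumes "C1_on U \<phi>"
  shows C1_on_vec_nth: "C1_on U (\<lambda>w. \<phi> w $ i)"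
    and partial_vec_nth:
      "\<And>e z. e \<in> {1, \<i>} \<Longrightarrow> z \<in> U \<Longrightarrow> partial e (\<lambda>w. \<phi> w $ i) z = partial e \<phi> z $ i"
proof -
  let ?D = "\<lambda>e z. partial e \<phi> z $ i"
  have 1: "has_partial (\<lambda>w. \<phi> w $ i) e z (partial e \<phi> z $ i)" if "e \<in> {1, \<i>}" "z \<in> U" for e z
    by (rule has_partial_vec_nth[OF C1_onD(1)[OF assms that]])
  have 2: "continuous_on U (\<lambda>z. partial e \<phi> z $ i)" if "e \<in> {1, \<i>}" for e
    by (rule continuous_on_component[OF C1_onD(2)[OF assms that]])
  show "C1_on U (\<lambda>w. \<phi> w $ i)"
    by (rule C1_onI(1)[where D = ?D, OF 1 2])
  show "\<And>e z. e \<in> {1, \<i>} \<Longrightarrow> z \<in> U \<Longrightarrow> partial e (\<lambda>w. \<phi> w $ i) z = partial e \<phi> z $ i"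
    by (rule C1_onI(2)[where D = ?D, OF 1 2])
qed

lemma
  fixes a b c :: "complex \<Rightarrow> real"
  assumes a: "C1_on U a" and b: "C1_on U b" and c: "C1_on U c"
  shows C1_on_vector3: "C1_on U (\<lambda>w. vector [a w, b w, c w] :: real^3)"
    and partial_vector3: "\<And>e z. e \<in> {1, \<i>} \<Longrightarrow> z \<in> U \<Longrightarrow>
      partial e (\<lambda>w. vector [a w, b w, c w] :: real^3) z
        = vector [partial e a z, partial e b z, partial e c z]"
proof -
  let ?v = "\<lambda>w. vector [a w, b w, c w] :: real^3"
  let ?D = "\<lambda>e z. vector [partial e a z, partial e b z, partial e c z] :: real^3"
  have 1: "has_partial ?v e z (?D e z)" if "e \<in> {1, \<i>}" "z \<in> U" for e z
    unfolding has_partial_def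
    by (intro has_vector_derivative_vector3; fold has_partial_def)
       (rule C1_onD(1)[OF a that] C1_onD(1)[OF b that] C1_onD(1)[OF c that])+
  have 2: "continuous_on U (?D e)" if "e \<in> {1, \<i>}" for e
    unfolding continuous_on_def
  proof (intro ballI vec_tendstoI)
    fix z i assume z: "z \<in> U"
    show "((\<lambda>z. ?D e z $ i) \<longlongrightarrow> ?D e z $ i) (at z within U)"
      using exhaust_3[of i] z C1_onD(2)[OF a that] C1_onD(2)[OF b that] C1_onD(2)[OF c that]
      by (elim disjE) (simp_all add: continuous_on_def)
  qed
  show "C1_on U ?v"
    by (rule C1_onI(1)[where D = ?D, OF 1 2])
  show "\<And>e z. e \<in> {1, \<i>} \<Longrightarrow> z \<in> U \<Longrightarrow> partial e ?v z = ?D e z"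
    by (rule C1_onI(2)[where D = ?D, OF 1 2])
qed

lemma has_partial_Re: "has_partial Re e z (Re e)"
  and has_partial_Im: "has_partial Im e z (Im e)"
  and has_partial_const: "has_partial (\<lambda>_. c) e z 0"
  unfolding has_partial_def has_real_derivative_iff_has_vector_derivative[symmetric]
  by (auto intro!: derivative_eq_intros)

lemma C1_on_const: "C1_on U (\<lambda>_. c)"
proof -
  have "partial e (\<lambda>_. c) = (\<lambda>_. 0)" for e
    by (intro ext partial_eqI has_partial_const)
  then show ?thesis
    by (simp add: C1_on_altdef has_partial_const)
qed

lemma partial_Re: "partial e Re = (\<lambda>_. Re e)" and partial_Im: "partial e Im = (\<lambda>_. Im e)"
  and partial_const: "partial e (\<lambda>_. c) = (\<lambda>_. 0)"
  by (intro ext partial_eqI has_partial_Re has_partial_Im has_partial_const)+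

lemma C1_on_Re: "C1_on U Re" and C1_on_Im: "C1_on U Im"
  by (simp_all add: C1_on_altdef partial_Re partial_Im has_partial_Re has_partial_Im)

lemma partial_cong:
  assumes "open U" "z \<in> U" "\<And>w. w \<in> U \<Longrightarrow> \<phi> w = \<psi> w"
  shows "partial e \<phi> z = partial e \<psi> z"
  using has_partial_cong[where e = e and \<phi> = \<phi> and \<psi> = \<psi>, OF assms(1,2)] assms(3)
  unfolding has_partial_def partial_def vector_derivative_def by simp

theorem isotropic_minimal_graph_iff:
  assumes U: "open U"
  shows "isotropic_minimal U (graph_surface h) \<longleftrightarrow> harmonic_on U h"
proof -
  define X where "X = graph_surface h"
  have X: "X = (\<lambda>w. vector [Re w, Im w, h w])"
    by (simp add: X_def graph_surface_def fun_eq_iff)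
  have X3: "(\<lambda>w. X w $ 3) = h"
    by (simp add: X)
  have C2: "C2_on U X \<longleftrightarrow> C2_on U h"
  proof
    assume *: "C2_on U X"
    have "C1_on U h"
      using * C1_on_vec_nth[of U X 3] by (simp add: X3 C2_on_def)
    moreover have "C1_on U (partial e h)" if e: "e \<in> {1, \<i>}" for e
    proof (rule C1_on_cong[OF U])
      show "C1_on U (\<lambda>w. partial e X w $ 3)"
        using * e by (auto simp: C2_on_def intro: C1_on_vec_nth)
      show "partial e X w $ 3 = partial e h w" if "w \<in> U" for w
        using partial_vec_nth[of U X e w 3] * e that by (simp add: X3 C2_on_def)
    qed
    ultimately show "C2_on U h"
      by (simp add: C2_on_def)
  next
    assume *: "C2_on U h"
    have "C1_on U (partial e X)" if e: "e \<in> {1, \<i>}" for e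
    proof (rule C1_on_cong[OF U])
      show "C1_on U (\<lambda>w. vector [Re e, Im e, partial e h w] :: real^3)"
        using * e by (intro C1_on_vector3 C1_on_const) (auto simp: C2_on_def)
      show "vector [Re e, Im e, partial e h w] = partial e X w" if "w \<in> U" for w
        unfolding X
        by (subst partial_vector3[of U])
           (use * e that in \<open>auto simp: C1_on_Re C1_on_Im C2_on_def partial_Re partial_Im\<close>)
    qed
    moreover have "C1_on U X"
      unfolding X using * by (intro C1_on_vector3 C1_on_Re C1_on_Im) (auto simp: C2_on_def)
    ultimately show "C2_on U X"
      by (simp add: C2_on_def)
  qed
  have "first_form_det X z = 1 \<and> isotropic_mean_curvature X z = laplacian h z / 2"
    if h: "C2_on U h" and z: "z \<in> U" for z
  proof -
    have 1: "partial e X w = vector [Re e, Im e, partial e h w]" if "e \<in> {1, \<i>}" "w \<in> U" for e w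
      unfolding X
      by (subst partial_vector3[of U])
         (use h that in \<open>auto simp: C1_on_Re C1_on_Im C2_on_def partial_Re partial_Im\<close>)
    have 2: "partial d (partial e X) z = vector [0, 0, partial d (partial e h) z]"
      if "d \<in> {1, \<i>}" "e \<in> {1, \<i>}" for d e
    proof -
      have "partial d (partial e X) z = partial d (\<lambda>w. vector [Re e, Im e, partial e h w]) z"
        using 1 that by (intro partial_cong[OF U z]) auto
      also have "\<dots> = vector [0, 0, partial d (partial e h) z]"
        by (subst partial_vector3[of U])
           (use h z that in \<open>auto simp: C1_on_const C2_on_def partial_const\<close>)
      finally show ?thesis .
    qed
    have ff: "first_form X 1 1 z = 1" "first_form X \<i> \<i> z = 1" "first_form X 1 \<i> z = 0"
      using z by (simp_all add: first_form_def isotropic_metric_def 1)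
    then have W: "first_form_det X z = 1"
      by (simp add: first_form_det_def)
    have "second_form X d e z = partial e (partial d h) z" if "d \<in> {1, \<i>}" "e \<in> {1, \<i>}" for d e
      using that z by (simp add: second_form_def W 1 2 det_3)
    then show ?thesis
      by (simp add: isotropic_mean_curvature_def ff W laplacian_def)
  qed
  then show ?thesis
    unfolding isotropic_minimal_def harmonic_on_def X_def[symmetric] C2 by auto
qed


section \<open>Weierstrass products\<close>

text \<open>
  \<open>weierstrass_factor q w = (1 - w) * exp (w + w\<^sup>2/2 + \<dots> + w\<^sup>q/q)\<close>, so this is \<open>\<F>({a\<^sub>n}, q)\<close>.
\<close>

definition weierstrass_prod :: "(nat \<Rightarrow> complex) \<Rightarrow> nat \<Rightarrow> complex \<Rightarrow> complex" where
  "weierstrass_prod a q z = (\<Prod>n. weierstrass_factor q (z / a n))"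

text \<open>
  As usual for Weierstrass products, convergence means absolute convergence. For merely conditionally
  convergent products the products over residue classes of indices may diverge, as they do for
  \<open>sin (\<pi> z) / (\<pi> z) = (1 - z) (1 + z) (1 - z/2) (1 + z/2) \<cdots>\<close> with \<open>q = 0\<close> and two classes.
\<close>

definition weierstrass_prod_converges :: "(nat \<Rightarrow> complex) \<Rightarrow> nat \<Rightarrow> bool" where
  "weierstrass_prod_converges a q \<longleftrightarrow>
     (\<forall>z. abs_convergent_prod (\<lambda>n. weierstrass_factor q (z / a n)))"

definition weierstrass_representation ::
  "(complex \<Rightarrow> complex) \<Rightarrow> nat \<Rightarrow> (complex \<Rightarrow> complex) \<Rightarrow> (nat \<Rightarrow> complex) \<Rightarrow> nat \<Rightarrow> bool" where
  "weierstrass_representation f k g a q \<longleftrightarrow>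
     g holomorphic_on UNIV \<and> weierstrass_prod_converges a q \<and>
     (\<forall>z. f z = z ^ k * exp (g z) * weierstrass_prod a q z)"

text \<open>The zeros of \<open>f\<close> away from the origin are the \<open>a n\<close>, listed according to multiplicity.\<close>

definition zeros_listed :: "(complex \<Rightarrow> complex) \<Rightarrow> (nat \<Rightarrow> complex) \<Rightarrow> bool" where
  "zeros_listed f a \<longleftrightarrow>
     (\<forall>w. w \<noteq> 0 \<longrightarrow> (f w = 0 \<longleftrightarrow> w \<in> range a) \<and> finite {n. a n = w} \<and>
          (f w = 0 \<longrightarrow> zorder f w = int (card {n. a n = w})))"

text \<open>\<open>h = Re (ln f)\<close> on \<open>U\<close>, for a holomorphic branch of \<open>ln f\<close>.\<close>

definition is_Re_ln_on :: "complex set \<Rightarrow> (complex \<Rightarrow> complex) \<Rightarrow> (complex \<Rightarrow> real) \<Rightarrow> bool" where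
  "is_Re_ln_on U f h \<longleftrightarrow>
     (\<exists>L. L holomorphic_on U \<and> (\<forall>z\<in>U. exp (L z) = f z) \<and> (\<forall>z\<in>U. h z = Re (L z)))"

text \<open>The isotropic minimal surface over \<open>U\<close> with height \<open>u = Re (ln \<F>(a, q))\<close>.\<close>

definition weierstrass_surface ::
  "complex set \<Rightarrow> (nat \<Rightarrow> complex) \<Rightarrow> nat \<Rightarrow> (complex \<Rightarrow> real) \<Rightarrow> bool" where
  "weierstrass_surface U a q u \<longleftrightarrow>
     weierstrass_prod_converges a q \<and>
     weierstrass_prod a q holomorphic_on UNIV \<and>
     zeros_listed (weierstrass_prod a q) a \<and>
     is_Re_ln_on U (weierstrass_prod a q) u \<and>
     isotropic_minimal U (graph_surface u)"

text \<open>The decomposition of \<open>h\<close> into logarithmoids, \<open>m\<close> product surfaces, and the graph of \<open>Re g\<close>.\<close>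

definition surface_decomposition ::
  "complex set \<Rightarrow> (complex \<Rightarrow> real) \<Rightarrow> nat \<Rightarrow> nat \<Rightarrow> (nat \<Rightarrow> complex) \<Rightarrow> nat \<Rightarrow>
     (complex \<Rightarrow> complex) \<Rightarrow> (nat \<Rightarrow> complex \<Rightarrow> real) \<Rightarrow> bool" where
  "surface_decomposition U h k m a q g u \<longleftrightarrow>
     isotropic_minimal U (graph_surface logarithmoid) \<and>
     (\<forall>z\<in>U. (\<Sum>i<k. logarithmoid z) = real k * ln (cmod z)) \<and>
     (\<forall>j<m. weierstrass_surface U (\<lambda>i. a (m * i + j)) q (u j)) \<and>
     harmonic_on U (\<lambda>z. Re (g z)) \<and>
     isotropic_minimal U (graph_surface (\<lambda>z. Re (g z))) \<and>
     (\<forall>z\<in>U. h z = (\<Sum>i<k. logarithmoid z) + (\<Sum>j<m. u j z) + Re (g z))"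

end

theory Submission
  imports Defs
begin

text \<open>
  Absolute convergence of the product amounts to \<open>\<Sum>n. 1 / \<bar>a n\<bar> ^ (q + 1) < \<infinity>\<close>, a condition that passes
  to the subsequences \<open>a (m * i + j)\<close> and to larger \<open>q\<close>. The product therefore splits over the
  residue classes mod \<open>m\<close>, and taking \<open>ln \<bar>\<cdot>\<bar>\<close> gives the decomposition. For non-uniqueness, raising
  the degree from \<open>p\<close> to \<open>p + 1\<close> multiplies the product by \<open>exp (S * z ^ (p + 1) / (p + 1))\<close> with
  \<open>S = \<Sum>n. 1 / a n ^ (p + 1)\<close>, which is compensated by changing \<open>g\<close>. Not all of these power sums
  vanish, and the least \<open>p \<ge> q\<close> with \<open>S \<noteq> 0\<close> changes \<open>Re g\<close>, hence also one of the product surfaces.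
\<close>

section \<open>Weierstrass factors near the origin\<close>

lemma weierstrass_factor_Suc:
  "weierstrass_factor (Suc n) z = weierstrass_factor n z * exp (z ^ Suc n / of_nat (Suc n))"
  by (simp add: weierstrass_factor_def exp_add)

text \<open>With \<open>y = - z^(n+1) / (n+1)\<close>, the factor of degree \<open>n\<close> is
  \<open>exp y\<close> times the factor of degree \<open>n + 1\<close>. Near the origin
  \<open>exp y - 1\<close> has size at least \<open>|y| / 2\<close>, and the factor of degree
  \<open>n + 1\<close> differs from 1 only to order \<open>n + 2\<close>, which costs at most half
  of that.\<close>

lemma weierstrass_factor_lower_bound:
  assumes z: "norm z \<le> 1 / (24 * real (Suc n))"
  shows "norm z ^ Suc n / (4 * real (Suc n)) \<le> norm (weierstrass_factor n z - 1)"
proof -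
  define y where "y = - (z ^ Suc n / of_nat (Suc n))"
  have "1 / (24 * real (Suc n)) \<le> 1 / 24"
    by (simp add: field_simps)
  with z have z24: "norm z \<le> 1 / 24" by linarith
  have norm_y: "norm y = norm z ^ Suc n / real (Suc n)"
    by (simp add: y_def norm_divide norm_power norm_mult del: of_nat_Suc)
  have "norm z ^ Suc n \<le> norm z ^ 1"
    using z24 by (intro power_decreasing) auto
  then have "norm y \<le> norm z"
    unfolding norm_y by (simp add: field_simps) (smt (verit) mult_nonneg_nonneg norm_ge_zero of_nat_0_le_iff)
  with z24 have y: "norm y \<le> 1 / 2" by linarith
  have "norm (exp y) \<le> norm (exp y - 1) + norm (1 :: complex)"
    using norm_triangle_ineq[of "exp y - 1" 1] by simp
  also have "norm (exp y - 1) \<le> 3 / 2 * norm y"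
    by (rule norm_exp_bounds(2)[OF y])
  finally have exp_y: "norm (exp y) \<le> 2" using y by simp
  have bound: "norm (weierstrass_factor (Suc n) z - 1) \<le> 3 * norm z ^ Suc (Suc n)"
    using z24 by (intro weierstrass_factor_bound) simp
  have "weierstrass_factor n z - 1 = (exp y - 1) + (weierstrass_factor (Suc n) z - 1) * exp y"
    by (simp add: weierstrass_factor_Suc y_def exp_minus field_simps)
  then have "norm (exp y - 1) \<le> norm (weierstrass_factor n z - 1)
      + norm ((weierstrass_factor (Suc n) z - 1) * exp y)"
    by (metis add_diff_cancel_right' norm_triangle_ineq4)
  also have "norm ((weierstrass_factor (Suc n) z - 1) * exp y) \<le> (3 * norm z ^ Suc (Suc n)) * 2"
    unfolding norm_mult using bound exp_y by (intro mult_mono) auto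
  finally have 1: "norm (exp y - 1) \<le> norm (weierstrass_factor n z - 1) + 6 * norm z ^ Suc n * norm z"
    by (simp add: algebra_simps)
  \<comment> \<open>The radius comes from here: \<open>6 * |z|\<close> must not exceed
    \<open>1 / (4 * (n + 1))\<close>.\<close>
  have "6 * norm z ^ Suc n * norm z \<le> 6 * norm z ^ Suc n * (1 / (24 * real (Suc n)))"
    by (intro mult_left_mono z) auto
  also have "\<dots> = norm y / 4"
    unfolding norm_y by (simp del: of_nat_Suc power_Suc)
  finally have "6 * norm z ^ Suc n * norm z \<le> norm y / 4" .
  moreover have "norm y / 2 \<le> norm (exp y - 1)"
    using norm_exp_bounds(1)[OF y] by simp
  ultimately have "norm y / 4 \<le> norm (weierstrass_factor n z - 1)"
    using 1 by linarith
  then show ?thesis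
    by (simp add: norm_y mult.commute)
qed

section \<open>Zeros and convergence of products of constant degree\<close>

text \<open>A nonconstant entire function has finitely many zeros in each closed disc, and each is
  listed finitely often, so only finitely many indices fall into the disc.\<close>

lemma zeros_listed_tendsto_infinity:
  assumes f: "f holomorphic_on UNIV" and zeros: "zeros_listed f a" and a: "\<And>n. a n \<noteq> 0"
  shows "filterlim a at_infinity sequentially"
proof -
  \<comment> \<open>The listed zeros are countably many, so \<open>f\<close> is nonzero at some
    other point; since \<open>f (a 0) = 0\<close>, it is not constant.\<close>
  have "uncountable (UNIV - insert 0 (range a))"
    by (intro uncountable_minus_countable uncountable_UNIV_complex) auto
  then obtain w where "w \<notin> insert 0 (range a)"
    by (metis Diff_iff all_not_in_conv countable_empty)
  then have w: "f w \<noteq> 0"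
    using zeros by (auto simp: zeros_listed_def)
  have a0: "f (a 0) = 0"
    using zeros a by (auto simp: zeros_listed_def)
  have nonconst: "\<not> f constant_on UNIV"
    unfolding constant_on_def using w a0 by (metis UNIV_I)
  have fin: "finite {n. norm (a n) \<le> R}" for R
  proof -
    have "finite {z \<in> cball 0 R. f z = 0}"
      by (rule holomorphic_compact_finite_zeros[OF f]) (use nonconst in auto)
    moreover have "finite {n. a n = z}" if "z \<in> range a" for z
      using zeros a that by (auto simp: zeros_listed_def)
    ultimately have "finite (\<Union>z\<in>{z \<in> cball 0 R. f z = 0} \<inter> range a. {n. a n = z})"
      by (intro finite_UN_I) auto
    moreover have "f (a n) = 0" for n
      using zeros a by (auto simp: zeros_listed_def)
    then have "{n. norm (a n) \<le> R} \<subseteq> (\<Union>z\<in>{z \<in> cball 0 R. f z = 0} \<inter> range a. {n. a n = z})"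
      by auto
    ultimately show ?thesis by (rule rev_finite_subset)
  qed
  show ?thesis
    unfolding filterlim_at_infinity_conv_norm_at_top filterlim_at_top_dense
  proof
    fix R
    show "\<forall>\<^sub>F n in sequentially. R < norm (a n)"
      using fin[of R] by (simp add: cofinite_eq_sequentially[symmetric] eventually_cofinite not_less)
  qed
qed

text \<open>Makes holomorphy, zeros and their orders available from the locale
  \<open>weierstrass_product\<close>, used with a constant degree sequence.\<close>

lemma weierstrass_prod_conv_f:
  assumes "weierstrass_product a (\<lambda>_. q)"
  shows "weierstrass_prod a q = weierstrass_product.f a (\<lambda>_. q)"
  by (simp add: fun_eq_iff weierstrass_prod_def weierstrass_product.f_def[OF assms])

text \<open>Eventually \<open>|z / a n| < 1\<close>, so a power above \<open>q + 1\<close> is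
  dominated by the power \<open>q + 1\<close>.\<close>

lemma weierstrass_product_summable:
  assumes "weierstrass_product a (\<lambda>_. q)" "q < p"
  shows "summable (\<lambda>n. norm ((z / a n) ^ p))"
proof -
  interpret weierstrass_product a "\<lambda>_. q" by (rule assms)
  \<comment> \<open>The locale asks for a positive radius; adding 1 covers
    \<open>z = 0\<close>.\<close>
  have *: "summable (\<lambda>n. ((norm z + 1) / norm (a n)) ^ Suc q)"
    by (rule summable_a_p) (simp add: add_nonneg_pos)
  show ?thesis
  proof (rule summable_comparison_test_ev[OF _ *])
    have "\<forall>\<^sub>F n in sequentially. norm z + 1 < norm (a n)"
      using filterlim_a by (metis filterlim_at_infinity_imp_norm_at_top filterlim_at_top_dense)
    then show "\<forall>\<^sub>F n in sequentially.
        norm (norm ((z / a n) ^ p)) \<le> ((norm z + 1) / norm (a n)) ^ Suc q"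
    proof eventually_elim
      case (elim n)
      have "norm (z / a n) ^ p \<le> norm (z / a n) ^ Suc q"
        using elim assms(2) a_nonzero[of n] by (intro power_decreasing) (auto simp: norm_divide divide_simps)
      also have "\<dots> \<le> ((norm z + 1) / norm (a n)) ^ Suc q"
        unfolding norm_divide by (intro power_mono divide_right_mono) auto
      finally show ?case by (simp add: norm_power)
    qed
  qed
qed

lemma weierstrass_product_mono:
  assumes "weierstrass_product a (\<lambda>_. q)" "q \<le> p"
  shows "weierstrass_product a (\<lambda>_. p)"
proof
  interpret weierstrass_product a "\<lambda>_. q" by (rule assms)
  show "a n \<noteq> 0" for n by (rule a_nonzero)
  show "filterlim a at_infinity sequentially" by (rule filterlim_a)
  show "summable (\<lambda>n. (r / norm (a n)) ^ Suc p)" if "r > 0" for r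
    using weierstrass_product_summable[OF assms(1), of "Suc p" "of_real r"] assms(2) that
    by (simp add: norm_power norm_divide norm_mult)
qed

lemma weierstrass_product_subseq:
  assumes "weierstrass_product a (\<lambda>_. q)" "strict_mono r"
  shows "weierstrass_product (\<lambda>i. a (r i)) (\<lambda>_. q)"
proof
  interpret weierstrass_product a "\<lambda>_. q" by (rule assms)
  show "a (r n) \<noteq> 0" for n by (rule a_nonzero)
  show "filterlim (\<lambda>i. a (r i)) at_infinity sequentially"
    by (rule filterlim_compose[OF filterlim_a filterlim_subseq[OF assms(2)]])
  show "summable (\<lambda>n. (R / norm (a (r n))) ^ Suc q)" if "R > 0" for R
    using summable_reindex[OF summable_a_p[OF that] strict_mono_imp_inj_on[OF assms(2)]] that
    by (simp add: o_def del: power_Suc)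
qed

text \<open>Absolute convergence at the single point \<open>z = 1\<close> already makes \<open>\<Sum>n. 1 / \<bar>a n\<bar> ^ (q + 1)\<close>
  converge, since \<open>weierstrass_factor q w - 1\<close> vanishes to order exactly \<open>q + 1\<close> at \<open>0\<close>.\<close>

lemma weierstrass_prod_converges_imp_product:
  assumes conv: "weierstrass_prod_converges a q"
    and a: "\<And>n. a n \<noteq> 0" and lim: "filterlim a at_infinity sequentially"
  shows "weierstrass_product a (\<lambda>_. q)"
proof
  show "a n \<noteq> 0" for n by (rule a)
  show "filterlim a at_infinity sequentially" by (rule lim)
  have "summable (\<lambda>n. norm (weierstrass_factor q (1 / a n) - 1))"
    using conv by (simp add: weierstrass_prod_converges_def abs_convergent_prod_conv_summable)
  then have sum: "summable (\<lambda>n. 4 * real (Suc q) * norm (weierstrass_factor q (1 / a n) - 1))"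
    by (rule summable_mult)
  have "summable (\<lambda>n. norm (1 / a n) ^ Suc q)"
  proof (rule summable_comparison_test_ev[OF _ sum])
    \<comment> \<open>From here on \<open>1 / a n\<close> lies within the radius of the lower
      bound.\<close>
    have "\<forall>\<^sub>F n in sequentially. 24 * real (Suc q) < norm (a n)"
      using lim by (metis filterlim_at_infinity_imp_norm_at_top filterlim_at_top_dense)
    then show "\<forall>\<^sub>F n in sequentially. norm (norm (1 / a n) ^ Suc q)
        \<le> 4 * real (Suc q) * norm (weierstrass_factor q (1 / a n) - 1)"
    proof eventually_elim
      case (elim n)
      have "norm (1 / a n) \<le> 1 / (24 * real (Suc q))"
        unfolding norm_divide norm_one using elim by (intro divide_left_mono) (auto simp: a)
      from weierstrass_factor_lower_bound[OF this] show ?case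
        by (simp add: pos_divide_le_eq mult.commute del: of_nat_Suc)
    qed
  qed
  then have "summable (\<lambda>n. r ^ Suc q * norm (1 / a n) ^ Suc q)" for r
    by (rule summable_mult)
  then show "summable (\<lambda>n. (r / norm (a n)) ^ Suc q)" for r
    by (simp add: norm_divide power_divide)
qed

lemma weierstrass_product_converges:
  assumes "weierstrass_product a (\<lambda>_. q)"
  shows "weierstrass_prod_converges a q"
  using weierstrass_product.abs_convergent[OF assms] by (simp add: weierstrass_prod_converges_def)

lemma weierstrass_product_zeros_listed:
  assumes "weierstrass_product a (\<lambda>_. q)"
  shows "zeros_listed (weierstrass_prod a q) a"
  using weierstrass_product.zero[OF assms] weierstrass_product.zorder[OF assms]
    weierstrass_product.finite_occs_a[OF assms]
  by (simp add: zeros_listed_def weierstrass_prod_conv_f[OF assms] vimage_def)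

section \<open>Raising the degree and splitting the product\<close>

text \<open>Each factor gains \<open>exp ((z / a n)^(q+1) / (q+1))\<close>, and these exponents have
  an absolutely convergent sum. The gain has no zeros, so it can be absorbed into
  \<open>exp (g z)\<close>.\<close>

lemma weierstrass_prod_Suc:
  assumes "weierstrass_product a (\<lambda>_. q)"
  shows "weierstrass_prod a (Suc q) z =
    weierstrass_prod a q z * exp ((\<Sum>n. (1 / a n) ^ Suc q) * z ^ Suc q / of_nat (Suc q))"
proof -
  have "summable (\<lambda>n. (1 / a n) ^ Suc q)"
    by (rule summable_norm_cancel, rule weierstrass_product_summable[OF assms]) simp
  then have "(\<lambda>n. (1 / a n) ^ Suc q * (z ^ Suc q / of_nat (Suc q))) sums
      ((\<Sum>n. (1 / a n) ^ Suc q) * (z ^ Suc q / of_nat (Suc q)))"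
    by (intro sums_mult2 summable_sums)
  moreover have "(1 / a n) ^ Suc q * (z ^ Suc q / of_nat (Suc q)) = (z / a n) ^ Suc q / of_nat (Suc q)" for n
    by (simp add: power_divide)
  ultimately have sums: "(\<lambda>n. (z / a n) ^ Suc q / of_nat (Suc q)) sums
      ((\<Sum>n. (1 / a n) ^ Suc q) * z ^ Suc q / of_nat (Suc q))"
    by (simp del: power_Suc of_nat_Suc)
  show ?thesis
    unfolding weierstrass_prod_def weierstrass_factor_Suc
    using prodinf_exp[OF sums_summable[OF sums]] sums_unique[OF sums]
      prodinf_mult[OF weierstrass_product.convergent[OF assms] convergent_prod_exp[OF sums_summable[OF sums]], of z]
    by simp
qed

text \<open>The first \<open>N * m\<close> factors regroup exactly into \<open>m\<close> products of
  \<open>N\<close> factors each; both sides are limits of these finite products.\<close>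

lemma prodinf_residue_classes:
  fixes f :: "nat \<Rightarrow> 'a :: {real_normed_field}"
  assumes m: "m > 0" and f: "convergent_prod f"
    and fj: "\<And>j. j < m \<Longrightarrow> convergent_prod (\<lambda>i. f (m * i + j))"
  shows "prodinf f = (\<Prod>j<m. \<Prod>i. f (m * i + j))"
proof -
  have lim: "(\<lambda>N. \<Prod>n<N. g n) \<longlonglongrightarrow> prodinf g" if "convergent_prod g" for g :: "nat \<Rightarrow> 'a"
    using convergent_prod_LIMSEQ[OF that]
    by (subst filterlim_sequentially_Suc[symmetric]) (simp add: lessThan_Suc_atMost)
  have "(\<lambda>N. \<Prod>j<m. \<Prod>i<N. f (m * i + j)) \<longlonglongrightarrow> (\<Prod>j<m. \<Prod>i. f (m * i + j))"
    by (intro tendsto_prod lim fj) auto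
  moreover have "(\<Prod>j<m. \<Prod>i<N. f (m * i + j)) = (\<Prod>n<N * m. f n)" for N
  proof -
    have "(\<Prod>j<m. \<Prod>i<N. f (m * i + j)) = (\<Prod>i<N. \<Prod>j<m. f (m * i + j))"
      by (rule prod.swap)
    \<comment> \<open>The block of length \<open>m\<close> starting at \<open>i * m\<close> contains
      one index from each residue class.\<close>
    also have "\<dots> = (\<Prod>i<N. prod f {i * m..<i * m + m})"
      using prod.atLeastLessThan_shift_0[of f "m * _" "m * _ + m"]
      by (simp add: mult.commute atLeast0LessThan)
    also have "\<dots> = (\<Prod>n<N * m. f n)"
      by (rule prod.nat_group)
    finally show ?thesis .
  qed
  moreover have "(\<lambda>N. \<Prod>n<N * m. f n) \<longlonglongrightarrow> prodinf f"
    by (rule filterlim_compose[OF lim[OF f]])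
       (use m in \<open>auto intro!: filterlim_subseq simp: strict_mono_def\<close>)
  ultimately show ?thesis
    using LIMSEQ_unique by fastforce
qed

lemma weierstrass_prod_residue_classes:
  assumes W: "weierstrass_product a (\<lambda>_. q)" and m: "m > 0"
  shows "weierstrass_prod a q z = (\<Prod>j<m. weierstrass_prod (\<lambda>i. a (m * i + j)) q z)"
  unfolding weierstrass_prod_def
proof (rule prodinf_residue_classes[OF m weierstrass_product.convergent[OF W]])
  fix j
  have "weierstrass_product (\<lambda>i. a (m * i + j)) (\<lambda>_. q)"
    by (rule weierstrass_product_subseq[OF W]) (use m in \<open>simp add: strict_mono_def\<close>)
  then show "convergent_prod (\<lambda>i. weierstrass_factor q (z / a (m * i + j)))"
    by (rule weierstrass_product.convergent)
qed

text \<open>If all these power sums vanished, then raising \<open>q\<close> would not change the product. But the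
  products tend to \<open>1\<close> near the origin as \<open>q\<close> grows, so the product would be constantly \<open>1\<close>.\<close>

lemma weierstrass_product_power_sum_nonzero:
  assumes W: "weierstrass_product a (\<lambda>_. q)"
  shows "\<exists>p\<ge>q. (\<Sum>n. (1 / a n) ^ Suc p) \<noteq> 0"
proof (rule ccontr)
  assume "\<not> ?thesis"
  then have vanish: "(\<Sum>n. (1 / a n) ^ Suc p) = 0" if "p \<ge> q" for p
    using that by metis
  have Wp: "weierstrass_product a (\<lambda>_. p)" if "p \<ge> q" for p
    using weierstrass_product_mono[OF W that] .
  have eq: "weierstrass_prod a p z = weierstrass_prod a q z" if "p \<ge> q" for p z
    using that
  proof (induction p rule: dec_induct)
    case (step p)
    then show ?case
      using weierstrass_prod_Suc[OF Wp[OF step(1)], of z] vanish[OF step(1)] by simp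
  qed simp
  interpret weierstrass_product a "\<lambda>_. q" by (rule W)
  \<comment> \<open>Half of a positive lower bound for all \<open>|a n|\<close> is halved once more
    in effect: on the ball of radius \<open>R\<close>, every \<open>|z / a n|\<close> is at most
    1/2.\<close>
  obtain R where R: "R > 0" "\<And>n. 2 * R \<le> norm (a n)"
  proof -
    have "\<forall>\<^sub>F n in sequentially. 1 < norm (a n)"
      using filterlim_a by (metis filterlim_at_infinity_imp_norm_at_top filterlim_at_top_dense)
    then obtain N where N: "\<And>n. n \<ge> N \<Longrightarrow> 1 < norm (a n)"
      by (auto simp: eventually_sequentially)
    define M where "M = Min (insert 1 ((\<lambda>n. norm (a n)) ` {..<N}))"
    have "M > 0"
      using a_nonzero by (simp add: M_def)
    moreover have "M \<le> norm (a n)" for n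
    proof (cases "n < N")
      case False
      have "M \<le> 1" by (simp add: M_def)
      with N[of n] False show ?thesis by simp
    qed (simp add: M_def)
    ultimately show ?thesis by (intro that[of "M / 2"]) auto
  qed
  have one: "weierstrass_prod a q z = 1" if z: "z \<in> ball 0 R" for z
  proof -
    define C where "C = (\<Sum>n. norm (z / a n) ^ Suc q)"
    have sumC: "summable (\<lambda>n. norm (z / a n) ^ Suc q)"
      using weierstrass_product_summable[OF W lessI, of z] by (simp only: norm_power)
    have half: "norm (z / a n) \<le> 1 / 2" for n
      using z R(2)[of n] a_nonzero[of n] by (simp add: norm_divide divide_simps)
    \<comment> \<open>By \<open>eq\<close> the product is the same for all degrees
      \<open>q + i\<close>, so every \<open>i\<close> yields a bound on the same quantity.\<close>
    have bound: "norm (weierstrass_prod a q z - 1) \<le> exp (3 * (1 / 2) ^ i * C) - 1" for i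
    proof -
      let ?E = "\<lambda>n. weierstrass_factor (q + i) (z / a n)"
      have E: "norm (?E n - 1) \<le> 3 * (1 / 2) ^ i * norm (z / a n) ^ Suc q" for n
      proof -
        have "norm (?E n - 1) \<le> 3 * norm (z / a n) ^ Suc (q + i)"
          by (rule weierstrass_factor_bound[OF half])
        \<comment> \<open>Of the \<open>q + i + 1\<close> powers, \<open>i\<close> give the decay in
          \<open>i\<close> and \<open>q + 1\<close> keep the sum over \<open>n\<close>
          finite.\<close>
        also have "\<dots> = 3 * (norm (z / a n) ^ i * norm (z / a n) ^ Suc q)"
          by (simp add: power_add mult_ac)
        also have "\<dots> \<le> 3 * ((1 / 2) ^ i * norm (z / a n) ^ Suc q)"
          using half[of n] by (intro mult_left_mono mult_right_mono power_mono) auto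
        finally show ?thesis by simp
      qed
      have "(\<lambda>N. norm ((\<Prod>n\<le>N. ?E n) - 1)) \<longlonglongrightarrow> norm (weierstrass_prod a (q + i) z - 1)"
        unfolding weierstrass_prod_def
        by (intro tendsto_intros convergent_prod_LIMSEQ weierstrass_product.convergent Wp) simp
      moreover have "norm ((\<Prod>n\<le>N. ?E n) - 1) \<le> exp (3 * (1 / 2) ^ i * C) - 1" for N
      proof -
        have "norm ((\<Prod>n\<le>N. ?E n) - 1) \<le> (\<Prod>n\<le>N. 1 + norm (?E n - 1)) - 1"
          using norm_prod_minus1_le_prod_minus1[of "\<lambda>n. ?E n - 1" "{..N}"] by simp
        also have "(\<Prod>n\<le>N. 1 + norm (?E n - 1)) \<le> exp (\<Sum>n\<le>N. norm (?E n - 1))"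
          by (rule prod_le_exp_sum) simp
        also have "(\<Sum>n\<le>N. norm (?E n - 1)) \<le> (\<Sum>n\<le>N. 3 * (1 / 2) ^ i * norm (z / a n) ^ Suc q)"
          by (intro sum_mono E)
        also have "\<dots> \<le> 3 * (1 / 2) ^ i * C"
          unfolding C_def sum_distrib_left[symmetric]
          by (intro mult_left_mono sum_le_suminf sumC) auto
        finally show ?thesis by simp
      qed
      ultimately have "norm (weierstrass_prod a (q + i) z - 1) \<le> exp (3 * (1 / 2) ^ i * C) - 1"
        by (intro LIMSEQ_le_const2) auto
      then show ?thesis
        using eq[of "q + i" z] by simp
    qed
    have "(\<lambda>i. exp (3 * (1 / 2) ^ i * C) - 1) \<longlonglongrightarrow> exp (3 * 0 * C) - 1"
      by (intro tendsto_intros LIMSEQ_power_zero) simp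
    then have "norm (weierstrass_prod a q z - 1) \<le> exp (3 * 0 * C) - 1"
      by (rule LIMSEQ_le_const) (use bound in auto)
    then show ?thesis by simp
  qed
  \<comment> \<open>The identity theorem carries the value 1 from the ball to the zero
    \<open>a 0\<close>, a contradiction.\<close>
  have "weierstrass_prod a q (a 0) = 1"
  proof (rule analytic_continuation_open[of "ball 0 R" UNIV "weierstrass_prod a q" "\<lambda>_. 1"])
    show "weierstrass_prod a q holomorphic_on UNIV"
      unfolding weierstrass_prod_conv_f[OF W] by (rule holomorphic)
  qed (use R one in auto)
  moreover have "weierstrass_prod a q (a 0) = 0"
    unfolding weierstrass_prod_conv_f[OF W] zero by simp
  ultimately show False by simp
qed

section \<open>Real parts of holomorphic functions\<close>

lemma has_partial_Re_holomorphic: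
  assumes "F holomorphic_on U" "open U" "z \<in> U"
  shows "has_partial (\<lambda>w. Re (F w)) e z (Re (e * deriv F z))"
proof -
  have "((\<lambda>t::real. z + t *\<^sub>R e) has_vector_derivative e) (at 0)"
    by (auto intro!: derivative_eq_intros)
  moreover have "(F has_field_derivative deriv F z) (at (z + 0 *\<^sub>R e))"
    using holomorphic_derivI[OF assms] by simp
  ultimately have "((F \<circ> (\<lambda>t::real. z + t *\<^sub>R e)) has_vector_derivative e * deriv F z) (at 0)"
    by (rule field_vector_diff_chain_at)
  then show ?thesis
    unfolding has_partial_def o_def
    by (rule bounded_linear.has_vector_derivative[OF bounded_linear_Re])
qed

lemma
  assumes F: "F holomorphic_on U" and U: "open U"
  shows C1_on_Re_holomorphic: "C1_on U (\<lambda>w. Re (F w))"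
    and partial_Re_holomorphic: "\<And>e z. z \<in> U \<Longrightarrow> partial e (\<lambda>w. Re (F w)) z = Re (e * deriv F z)"
proof -
  show "C1_on U (\<lambda>w. Re (F w))"
  proof (rule C1_onI(1)[where D = "\<lambda>e z. Re (e * deriv F z)"])
    show "has_partial (\<lambda>w. Re (F w)) e z (Re (e * deriv F z))" if "z \<in> U" for e z
      by (rule has_partial_Re_holomorphic[OF F U that])
    show "continuous_on U (\<lambda>z. Re (e * deriv F z))" for e
      by (intro continuous_intros holomorphic_on_imp_continuous_on holomorphic_deriv F U)
  qed
  show "\<And>e z. z \<in> U \<Longrightarrow> partial e (\<lambda>w. Re (F w)) z = Re (e * deriv F z)"
    by (rule partial_eqI[OF has_partial_Re_holomorphic[OF F U]])
qed

text \<open>The second derivative in direction \<open>e\<close> is \<open>Re (e^2 * F'')\<close>;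
  for \<open>e = 1\<close> and \<open>e = \<i>\<close> these cancel.\<close>

lemma harmonic_on_Re_holomorphic:
  assumes F: "F holomorphic_on U" and U: "open U"
  shows "harmonic_on U (\<lambda>w. Re (F w))"
proof -
  have hol: "(\<lambda>w. e * deriv F w) holomorphic_on U" for e
    by (intro holomorphic_intros holomorphic_deriv F U)
  have "C1_on U (partial e (\<lambda>w. Re (F w)))" for e
    by (rule C1_on_cong[OF U _ C1_on_Re_holomorphic[OF hol[of e] U]])
       (simp add: partial_Re_holomorphic[OF F U])
  moreover have "partial e (partial e (\<lambda>w. Re (F w))) z = Re (e * (e * deriv (deriv F) z))"
    if z: "z \<in> U" for e z
  proof -
    have "partial e (partial e (\<lambda>w. Re (F w))) z = partial e (\<lambda>w. Re (e * deriv F w)) z"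
      by (rule partial_cong[OF U z]) (rule partial_Re_holomorphic[OF F U])
    also have "\<dots> = Re (e * deriv (\<lambda>w. e * deriv F w) z)"
      by (rule partial_Re_holomorphic[OF hol U z])
    also have "deriv (\<lambda>w. e * deriv F w) z = e * deriv (deriv F) z"
      using holomorphic_on_imp_differentiable_at[OF holomorphic_deriv[OF F U] U z]
      by (rule deriv_cmult)
    finally show ?thesis .
  qed
  ultimately show ?thesis
    using C1_on_Re_holomorphic[OF F U]
    by (simp add: harmonic_on_def C2_on_def laplacian_def mult.assoc[symmetric])
qed

text \<open>The directions 1 and \<open>\<i>\<close> read off the real part and minus the imaginary
  part of \<open>F'\<close>. This later shows that the change in \<open>Re g\<close> is not
  identically zero.\<close>

lemma Re_holomorphic_zero_imp_deriv_zero: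
  assumes F: "F holomorphic_on U" and U: "open U" "z \<in> U" and zero: "\<And>w. w \<in> U \<Longrightarrow> Re (F w) = 0"
  shows "deriv F z = 0"
proof -
  have "Re (e * deriv F z) = 0" for e
  proof -
    have "Re (e * deriv F z) = partial e (\<lambda>w. Re (F w)) z"
      by (rule partial_Re_holomorphic[OF F U, symmetric])
    also have "\<dots> = partial e (\<lambda>_. 0) z"
      by (rule partial_cong[OF U zero])
    finally show ?thesis by (simp add: partial_const)
  qed
  from this[of 1] this[of \<i>] show ?thesis
    by (simp add: complex_eq_iff)
qed

lemma harmonic_on_cong:
  assumes U: "open U" and eq: "\<And>w. w \<in> U \<Longrightarrow> \<phi> w = \<psi> w" and h: "harmonic_on U \<phi>"
  shows "harmonic_on U \<psi>"
proof -
  have 1: "partial e \<phi> w = partial e \<psi> w" if "w \<in> U" for e w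
    by (rule partial_cong[OF U that eq])
  have 2: "partial e (partial e \<phi>) w = partial e (partial e \<psi>) w" if "w \<in> U" for e w
    by (rule partial_cong[OF U that 1])
  have "C1_on U \<psi>"
    using h by (intro C1_on_cong[OF U eq]) (auto simp: harmonic_on_def C2_on_def)
  moreover have "C1_on U (partial e \<psi>)" if "e \<in> {1, \<i>}" for e
    using h that by (intro C1_on_cong[OF U 1]) (auto simp: harmonic_on_def C2_on_def)
  ultimately show ?thesis
    using h 2 by (simp add: harmonic_on_def C2_on_def laplacian_def)
qed

section \<open>Surfaces given by logarithms of moduli\<close>

text \<open>Since \<open>|exp L| = exp (Re L)\<close>, the height does not depend on the
  branch.\<close>

lemma is_Re_ln_on_eq_ln_cmod:
  assumes "is_Re_ln_on U f h" "z \<in> U"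
  shows "h z = ln (cmod (f z))"
proof -
  obtain L where "exp (L z) = f z" "h z = Re (L z)"
    using assms by (auto simp: is_Re_ln_on_def)
  then show ?thesis
    by (metis ln_exp norm_exp_eq_Re)
qed

text \<open>Simple connectivity enters here: it gives a zero-free holomorphic function a holomorphic
  logarithm.\<close>

lemma is_Re_ln_on_ln_cmod:
  assumes U: "open U" "simply_connected U" and f: "f holomorphic_on U" "\<And>z. z \<in> U \<Longrightarrow> f z \<noteq> 0"
  shows "is_Re_ln_on U f (\<lambda>z. ln (cmod (f z)))"
proof -
  obtain L where L: "L holomorphic_on U" "\<forall>z\<in>U. f z = exp (L z)"
    using U f simply_connected_eq_holomorphic_log[OF U(1)] by blast
  then show ?thesis
    by (auto simp: is_Re_ln_on_def intro!: exI[of _ L])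
qed

lemma is_Re_ln_on_imp_isotropic_minimal:
  assumes "open U" "is_Re_ln_on U f h"
  shows "isotropic_minimal U (graph_surface h)"
proof -
  obtain L where L: "L holomorphic_on U" "\<forall>z\<in>U. h z = Re (L z)"
    using assms by (auto simp: is_Re_ln_on_def)
  have "harmonic_on U h"
    by (rule harmonic_on_cong[OF assms(1) _ harmonic_on_Re_holomorphic[OF L(1) assms(1)]])
       (simp add: L)
  then show ?thesis
    by (simp add: isotropic_minimal_graph_iff assms)
qed

lemma weierstrass_surface_ln_cmod:
  assumes U: "open U" "simply_connected U" "U \<inter> range a = {}"
    and W: "weierstrass_product a (\<lambda>_. q)"
  shows "weierstrass_surface U a q (\<lambda>z. ln (cmod (weierstrass_prod a q z)))"
proof -
  have hol: "weierstrass_prod a q holomorphic_on A" for A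
    unfolding weierstrass_prod_conv_f[OF W] by (rule weierstrass_product.holomorphic[OF W])
  have nz: "weierstrass_prod a q z \<noteq> 0" if "z \<in> U" for z
    using that U(3) weierstrass_product.zero[OF W, of z]
    by (auto simp: weierstrass_prod_conv_f[OF W])
  have Re_ln: "is_Re_ln_on U (weierstrass_prod a q) (\<lambda>z. ln (cmod (weierstrass_prod a q z)))"
    by (rule is_Re_ln_on_ln_cmod[OF U(1,2) hol nz])
  show ?thesis
    unfolding weierstrass_surface_def
    using hol Re_ln is_Re_ln_on_imp_isotropic_minimal[OF U(1) Re_ln]
      weierstrass_product_converges[OF W] weierstrass_product_zeros_listed[OF W] by blast
qed

text \<open>The logarithm of the modulus turns the product over residue classes into a sum. The
  representation is arbitrary, so the result serves both the given degree and the raised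
  one.\<close>

lemma surface_decomposition_ln_cmod:
  assumes rep: "weierstrass_representation f k g a q" and W: "weierstrass_product a (\<lambda>_. q)"
    and m: "m > 0" and U: "open U" "simply_connected U" "0 \<notin> U" "U \<inter> range a = {}"
    and h: "is_Re_ln_on U f h"
  shows "surface_decomposition U h k m a q g
    (\<lambda>j z. ln (cmod (weierstrass_prod (\<lambda>i. a (m * i + j)) q z)))"
    (is "surface_decomposition _ _ _ _ _ _ _ ?u")
proof -
  have g: "g holomorphic_on A" for A
    using rep by (auto simp: weierstrass_representation_def intro: holomorphic_on_subset)
  have "isotropic_minimal U (graph_surface logarithmoid)"
  proof (rule is_Re_ln_on_imp_isotropic_minimal[OF U(1)])
    show "is_Re_ln_on U (\<lambda>z. z) logarithmoid"
      unfolding logarithmoid_def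
      by (rule is_Re_ln_on_ln_cmod[OF U(1,2)]) (use U(3) in auto)
  qed
  moreover have "\<forall>z\<in>U. (\<Sum>i<k. logarithmoid z) = real k * ln (cmod z)"
    by (simp add: logarithmoid_def)
  moreover have "weierstrass_surface U (\<lambda>i. a (m * i + j)) q (?u j)" for j
    by (rule weierstrass_surface_ln_cmod[OF U(1,2) _ weierstrass_product_subseq[OF W]])
       (use U(4) m in \<open>auto simp: strict_mono_def\<close>)
  moreover have harm: "harmonic_on U (\<lambda>z. Re (g z))"
    by (rule harmonic_on_Re_holomorphic[OF g U(1)])
  moreover have "isotropic_minimal U (graph_surface (\<lambda>z. Re (g z)))"
    using harm isotropic_minimal_graph_iff[OF U(1)] by blast
  moreover have "h z = (\<Sum>i<k. logarithmoid z) + (\<Sum>j<m. ?u j z) + Re (g z)" if z: "z \<in> U" for z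
  proof -
    have z0: "z \<noteq> 0" using z U(3) by auto
    have "weierstrass_prod a q z \<noteq> 0"
      using z U(4) weierstrass_product.zero[OF W, of z] by (auto simp: weierstrass_prod_conv_f[OF W])
    \<comment> \<open>A class product that vanished at \<open>z\<close> would make the whole product
      vanish there.\<close>
    then have nz: "weierstrass_prod (\<lambda>i. a (m * i + j)) q z \<noteq> 0" if "j < m" for j
      using that by (auto simp: weierstrass_prod_residue_classes[OF W m])
    then have prod_pos: "(\<Prod>j<m. cmod (weierstrass_prod (\<lambda>i. a (m * i + j)) q z)) > 0"
      by (intro prod_pos) auto
    have ln_prod: "ln (\<Prod>j<m. cmod (weierstrass_prod (\<lambda>i. a (m * i + j)) q z)) = (\<Sum>j<m. ?u j z)"
      by (rule ln_prod) (use nz in auto)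
    have "h z = ln (cmod (f z))"
      by (rule is_Re_ln_on_eq_ln_cmod[OF h z])
    also have "f z = z ^ k * exp (g z) * (\<Prod>j<m. weierstrass_prod (\<lambda>i. a (m * i + j)) q z)"
      using rep by (simp add: weierstrass_representation_def weierstrass_prod_residue_classes[OF W m])
    also have "ln (cmod \<dots>) = real k * ln (cmod z) + Re (g z) + (\<Sum>j<m. ?u j z)"
      unfolding norm_mult norm_power norm_exp_eq_Re prod_norm[symmetric] ln_prod[symmetric]
      using z0 prod_pos by (simp add: ln_mult ln_realpow del: prod_zero_iff)
    finally show ?thesis by (simp add: logarithmoid_def)
  qed
  ultimately show ?thesis
    by (simp add: surface_decomposition_def)
qed

section \<open>Decomposition and its non-uniqueness\<close>

theorem theorem5p4:
  fixes a :: "nat \<Rightarrow> complex" and f g :: "complex \<Rightarrow> complex" and h :: "complex \<Rightarrow> real"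
    and k q m :: nat and U :: "complex set"
  assumes a_nonzero: "\<And>n. a n \<noteq> 0"
    and f_entire: "f holomorphic_on UNIV"
    and f_zeros: "zeros_listed f a"
    and f_order_0: "zorder f 0 = int k"
    and f_product: "weierstrass_representation f k g a q"
    and m_pos: "m > 0"
    and U_domain: "open U" "U \<noteq> {}" "simply_connected U"
    and U_avoids_zeros: "0 \<notin> U" "U \<inter> range a = {}"
    and h_Re_ln: "is_Re_ln_on U f h"
    and X_minimal: "isotropic_minimal U (graph_surface h)"
  shows "\<exists>u. surface_decomposition U h k m a q g u \<and>
             (\<exists>v. weierstrass_surface U a q v) \<and>
             (\<exists>q' g' u'. weierstrass_representation f k g' a q' \<and>
                surface_decomposition U h k m a q' g' u' \<and>
                (\<exists>z\<in>U. Re (g' z) \<noteq> Re (g z)) \<and>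
                (\<exists>j<m. \<exists>z\<in>U. u' j z \<noteq> u j z))"
proof -
  have W: "weierstrass_product a (\<lambda>_. q)"
    using f_product a_nonzero zeros_listed_tendsto_infinity[OF f_entire f_zeros a_nonzero]
    by (intro weierstrass_prod_converges_imp_product) (auto simp: weierstrass_representation_def)
  define S where "S p = (\<Sum>n. (1 / a n) ^ Suc p)" for p
  \<comment> \<open>By minimality the degrees from \<open>q\<close> to \<open>p\<close> all give the
    same product; only the step to \<open>Suc p\<close> changes it.\<close>
  define p where "p = (LEAST p. p \<ge> q \<and> S p \<noteq> 0)"
  have "\<exists>p. p \<ge> q \<and> S p \<noteq> 0"
    unfolding S_def by (rule weierstrass_product_power_sum_nonzero[OF W])
  then have "p \<ge> q \<and> S p \<noteq> 0"
    unfolding p_def by (rule LeastI_ex)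
  then have p: "p \<ge> q" "S p \<noteq> 0" by auto
  have least: "S r = 0" if "q \<le> r" "r < p" for r
    using that not_less_Least unfolding p_def by blast
  have Wp: "weierstrass_product a (\<lambda>_. r)" if "r \<ge> q" for r
    by (rule weierstrass_product_mono[OF W that])
  have eq: "weierstrass_prod a p z = weierstrass_prod a q z" for z
    using p(1)
  proof (induction rule: inc_induct)
    case (step r)
    then show ?case
      using weierstrass_prod_Suc[OF Wp[of r], of z] least[of r] by (simp add: S_def)
  qed simp
  \<comment> \<open>\<open>exp (D z)\<close> is the factor gained in passing to degree
    \<open>Suc p\<close>; subtracting \<open>D\<close> from \<open>g\<close> leaves \<open>f\<close>
    unchanged.\<close>
  define D where "D z = S p * z ^ Suc p / of_nat (Suc p)" for z
  define g' where "g' z = g z - D z" for z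
  have D_hol: "D holomorphic_on A" for A
    unfolding D_def by (intro holomorphic_intros) (simp del: of_nat_Suc)
  have rep': "weierstrass_representation f k g' a (Suc p)"
    unfolding weierstrass_representation_def
  proof (intro conjI allI)
    show "g' holomorphic_on UNIV"
      unfolding g'_def using f_product D_hol
      by (intro holomorphic_intros) (auto simp: weierstrass_representation_def)
    show "weierstrass_prod_converges a (Suc p)"
      using p(1) by (intro weierstrass_product_converges Wp) simp
    fix z
    have "weierstrass_prod a (Suc p) z = weierstrass_prod a q z * exp (D z)"
      unfolding eq[symmetric] D_def S_def by (rule weierstrass_prod_Suc[OF Wp[OF p(1)]])
    then show "f z = z ^ k * exp (g' z) * weierstrass_prod a (Suc p) z"
      using f_product by (simp add: weierstrass_representation_def g'_def exp_diff)
  qed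
  define u where "u q j z = ln (cmod (weierstrass_prod (\<lambda>i. a (m * i + j)) q z))" for q j z
  have dec: "surface_decomposition U h k m a q g (u q)"
    unfolding u_def
    by (rule surface_decomposition_ln_cmod[OF f_product W m_pos U_domain(1,3) U_avoids_zeros h_Re_ln])
  have dec': "surface_decomposition U h k m a (Suc p) g' (u (Suc p))"
    unfolding u_def using p(1)
    by (intro surface_decomposition_ln_cmod[OF rep' _ m_pos U_domain(1,3) U_avoids_zeros h_Re_ln] Wp) simp
  have g_diff: "\<exists>z\<in>U. Re (g' z) \<noteq> Re (g z)"
  proof (rule ccontr)
    assume "\<not> ?thesis"
    then have "Re (D z) = 0" if "z \<in> U" for z
      using that by (auto simp: g'_def)
    moreover obtain z where z: "z \<in> U" using U_domain(2) by blast
    \<comment> \<open>But \<open>D' = S p * z^p\<close>, which is nonzero on \<open>U\<close>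
      because \<open>S p\<close> is nonzero and \<open>U\<close> omits 0.\<close>
    ultimately have "deriv D z = 0"
      by (intro Re_holomorphic_zero_imp_deriv_zero[OF D_hol U_domain(1)])
    moreover have "(D has_field_derivative S p * z ^ p) (at z)"
      unfolding D_def by (auto intro!: derivative_eq_intros simp del: of_nat_Suc power_Suc)
    then have "deriv D z = S p * z ^ p"
      by (rule DERIV_imp_deriv)
    ultimately show False
      using p(2) z U_avoids_zeros(1) by auto
  qed
  have "\<exists>j<m. \<exists>z\<in>U. u (Suc p) j z \<noteq> u q j z"
  proof (rule ccontr)
    assume "\<not> ?thesis"
    \<comment> \<open>Both decompositions share \<open>h\<close> and the logarithmoids, so equal
      product surfaces would force \<open>Re g' = Re g\<close>.\<close>
    then have "(\<Sum>j<m. u (Suc p) j z) = (\<Sum>j<m. u q j z)" if "z \<in> U" for z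
      using that by (intro sum.cong) auto
    then have "Re (g' z) = Re (g z)" if "z \<in> U" for z
      using that dec dec' unfolding surface_decomposition_def by fastforce
    with g_diff show False by blast
  qed
  with dec dec' rep' g_diff weierstrass_surface_ln_cmod[OF U_domain(1,3) U_avoids_zeros(2) W]
  show ?thesis by blast
qed

end
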